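(* Let $P$ be a multivalued Datalog program, $Bk$ a background knowledge and $\Phi_P$ a function-set of $P$. Then the modified consequence transformation $modNT_P$ has a fixed point. If $P$ is positive (contains no negation), then it has a least fixed point.
   Context: Lattices. $L$ is $L_F=\{(x_1,x_2)\in[0,1]^2 : x_1+x_2\le 1\}$ with $(x_1,x_2)\le(y_1,y_2)\iff x_1\le y_1,\ x_2\ge y_2$, $\vec 0=(0,1)$, $\vec 1=(1,0)$; or $L_V=\{(x_1,x_2)\in[0,1]^2 : x_1\le x_2\}$ with the coordinatewise order, $\vec 0=(0,0)$, $\vec 1=(1,1)$ (or, in the ordinary fuzzy case, $[0,1]$). Conjunction is lattice minimum; negation is the standard one ($(x_1,x_2)\mapsto(x_2,x_1)$ on $L_F$, $(x_1,x_2)\mapsto(1-x_2,1-x_1)$ on $L_V$, $x\mapsto1-x$ on $[0,1]$). An implication operator on $L$ is a map $L\times L\to L$, decreasing in the first and increasing in the second argument, extending the classical implication on $\{\vec 0,\vec 1\}$. Programs. Terms are variables or constants. A rule is $(A\leftarrow A_1,\dots,A_k;\vec\beta;\vec I)$, $k\ge0$, with $A$ an atom, $A_i$ literals, $\vec\beta\in L$ a level, and $\vec I$ an implication operator on $L$ (or, in the bipolar case, a pair $(I_1,I_2)$ of implications on $[0,1]$); rules with $k=0$ are facts, with level $\vec\beta$. A rule is safe if all head variables occur in the body and all variables of negative literals also occur in positive body literals. A multivalued Datalog program is a finite set of safe rules of one of these kinds: fuzzy, intuitionistic, interval-valued or bipolar. Head levels. Given the body level, the head level $\vec\alpha_p$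 is computed as follows. In the fuzzy, intuitionistic and interval-valued cases, $\vec\alpha_{body}=\min_i\vec\alpha_{A_i}$ and $\vec\alpha_p=\min\{\vec\gamma\in L : \vec I(\vec\alpha_{body},\vec\gamma)\ge\vec\beta\}$ (operators being such that this minimum exists). In the bipolar case the coordinates are computed separately: the first is $\min\{\gamma : I_1(\alpha_{body1},\gamma)\ge\beta_1\}$ with $\alpha_{body1}=\min_i\alpha_{A_i1}$; the second is either (variant a) $\min\{\gamma : I_2(\alpha_{body2},\gamma)\ge\beta_2\}$ with $\alpha_{body2}=\min_i\alpha_{A_i2}$, or (variant b) $1-\min\{\gamma' : I_2(\alpha'_{body2},\gamma')\ge1-\beta_2\}$ with $\alpha'_{body2}=\min_i(1-\alpha_{A_i2})$; the resulting pairs are assumed to lie in $L$. Background knowledge. A proximity on a set $D$ is a map $\vec R:D\times D\to L$ with $\vec R(x,x)=\vec 1$ and $\vec R(x,y)=\vec R(y,x)$. The proximity set of $d\in D$ is the $L$-valued fuzzy set $R_d=\{(d',\vec R(d,d')) : d'\in D\}$. Given a set $G$ of ground terms and a set $S$ of predicate symbols with proximities $RG$, $RS$ on them, the background knowledge is $Bk=\{RG_t : t\in G\}\cup\{RS_p : p\in S\}$. (A term or predicate of $P$ not in $G$ or $S$ is close only to itself, with level $\vec 1$.) Function-set. For each predicate symbol $p$ of $P$ with $n$ arguments, $\Phi_P$ contains a kb-extended uncertainty function $\vec\varphi_p:L^{n+2}\to L$ that is monotone increasing in each argument and satisfies $\vec\varphi_p(\vec\alpha,\vec\lambda,\vec\lambda_1,\dots,\vec\lambda_n)\le\min(\vec\alpha,\vec\lambda,\vec\lambda_1,\dots,\vec\lambda_n)$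 and $\vec\varphi_p(\vec\alpha,\vec 1,\dots,\vec 1)=\vec\alpha$. Modified transformation. The modified Herbrand universe $modH_P$ consists of the constants of $P$ together with all ground terms occurring in $Bk$; $modB_P$ is the set of ground atoms with predicate symbols occurring in $P\cup Bk$ and arguments in $modH_P$. $FV(modB_P)$ is the complete lattice of $L$-valued fuzzy sets over $modB_P$ (pointwise order, union is pointwise join, atoms not listed have level $\vec 0$). $modNT_P:FV(modB_P)\to FV(modB_P)$ is defined by $$modNT_P(X)=\{(q(s_1,\dots,s_n),\vec\varphi_p(\vec\alpha_p,\vec\lambda_q,\vec\lambda_{s_1},\dots,\vec\lambda_{s_n})) : (q,\vec\lambda_q)\in RS_p,\ (s_i,\vec\lambda_{s_i})\in RG_{t_i},\ 1\le i\le n\}\cup X,$$ where $(p(t_1,\dots,t_n)\leftarrow A_1,\dots,A_k;\vec\beta;\vec I)\in\mathrm{ground}(P)$ (ground instances over $modH_P$) is a rule such that the atom $|A_i|$ underlying each $A_i$ occurs in $X$ with level $\vec\alpha_{|A_i|}$, and $\vec\alpha_p$ is the head level computed from these levels, where the level $\vec\alpha_{A_i}$ of the literal $A_i$ is $\vec\alpha_{|A_i|}$ if $A_i$ is positive and the negation of $\vec\alpha_{|A_i|}$ if $A_i$ is negative: in the fuzzy, intuitionistic and interval-valued cases $\vec\alpha_p=\min\{\vec\gamma\in L : \vec I(\min_i\vec\alpha_{A_i},\vec\gamma)\ge\vec\beta\}$, and in the bipolar case $\vec\alpha_p$ has first coordinate $\min\{\gamma : I_1(\min_i\alpha_{A_i1},\gamma)\ge\beta_1\}$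 and second coordinate $\min\{\gamma : I_2(\min_i\alpha_{A_i2},\gamma)\ge\beta_2\}$ (variant a) or $1-\min\{\gamma' : I_2(\min_i(1-\alpha_{A_i2}),\gamma')\ge1-\beta_2\}$ (variant b). Rules are applied one at a time; $X$ is a fixed point of $modNT_P$ if it is unchanged whichever such rule is used. *)

theory Defs
  imports Complex_Main
begin

class degree_lattice = complete_lattice +
  fixes neg :: "'a \<Rightarrow> 'a"

typedef unit_interval = "{0..1 :: real}" morphisms val Unit
  by (auto intro: exI[of _ 0])

lemma val_bounds: "0 \<le> val x" "val x \<le> 1"
  using val[of x] by auto

lemma val_Unit: "0 \<le> r \<Longrightarrow> r \<le> 1 \<Longrightarrow> val (Unit r) = r"
  by (simp add: Unit_inverse)

instantiation unit_interval :: linorder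
begin
definition "x \<le> y \<longleftrightarrow> val x \<le> val y" for x y :: unit_interval
definition "x < y \<longleftrightarrow> val x < val y" for x y :: unit_interval
instance
  by standard (auto simp: less_eq_unit_interval_def less_unit_interval_def val_inject)
end

instantiation unit_interval :: complete_lattice
begin
definition "bot = Unit 0"
definition "top = Unit 1"
definition "inf x y = min x y" for x y :: unit_interval
definition "sup x y = max x y" for x y :: unit_interval
definition "Inf A = (if A = {} then Unit 1 else Unit (INF x\<in>A. val x))" for A :: "unit_interval set"
definition "Sup A = (if A = {} then Unit 0 else Unit (SUP x\<in>A. val x))" for A :: "unit_interval set"

instance
proof
  fix A :: "unit_interval set" and x z :: unit_interval
  have bb: "bdd_below (val ` A)" and ba: "bdd_above (val ` A)"
    using val_bounds by (auto intro: bdd_belowI[of _ 0] bdd_aboveI[of _ 1])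
  have vI: "val (Inf A) = (INF x\<in>A. val x)" if ne: "A \<noteq> {}"
  proof -
    obtain a where "a \<in> A" using ne by blast
    then have "(INF x\<in>A. val x) \<le> 1"
      using cINF_lower[OF bb] val_bounds(2)[of a] by fastforce
    moreover have "0 \<le> (INF x\<in>A. val x)"
      using ne val_bounds by (intro cINF_greatest) auto
    ultimately show ?thesis using ne by (simp add: Inf_unit_interval_def val_Unit)
  qed
  have vS: "val (Sup A) = (SUP x\<in>A. val x)" if ne: "A \<noteq> {}"
  proof -
    obtain a where "a \<in> A" using ne by blast
    then have "0 \<le> (SUP x\<in>A. val x)"
      using cSUP_upper[OF _ ba] val_bounds(1)[of a] by fastforce
    moreover have "(SUP x\<in>A. val x) \<le> 1"
      using ne val_bounds by (intro cSUP_least) auto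
    ultimately show ?thesis using ne by (simp add: Sup_unit_interval_def val_Unit)
  qed
  show "x \<in> A \<Longrightarrow> Inf A \<le> x"
    using vI cINF_lower[OF bb] by (cases "A = {}") (simp_all add: less_eq_unit_interval_def)
  show "x \<in> A \<Longrightarrow> x \<le> Sup A"
    using vS cSUP_upper[OF _ ba] by (cases "A = {}") (simp_all add: less_eq_unit_interval_def)
  show "(\<And>x. x \<in> A \<Longrightarrow> z \<le> x) \<Longrightarrow> z \<le> Inf A"
  proof (cases "A = {}")
    case True
    then show ?thesis by (simp add: Inf_unit_interval_def less_eq_unit_interval_def val_Unit val_bounds)
  next
    case False
    assume "\<And>x. x \<in> A \<Longrightarrow> z \<le> x"
    then show ?thesis
      using False vI by (auto simp: less_eq_unit_interval_def intro!: cINF_greatest)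
  qed
  show "(\<And>x. x \<in> A \<Longrightarrow> x \<le> z) \<Longrightarrow> Sup A \<le> z"
  proof (cases "A = {}")
    case True
    then show ?thesis by (simp add: Sup_unit_interval_def less_eq_unit_interval_def val_Unit val_bounds)
  next
    case False
    assume "\<And>x. x \<in> A \<Longrightarrow> x \<le> z"
    then show ?thesis
      using False vS by (auto simp: less_eq_unit_interval_def intro!: cSUP_least)
  qed
qed (auto simp: inf_unit_interval_def sup_unit_interval_def bot_unit_interval_def
    top_unit_interval_def Inf_unit_interval_def Sup_unit_interval_def)
end

instantiation unit_interval :: degree_lattice
begin
definition "neg x = Unit (1 - val x)"
instance ..
end

lemma val_neg [simp]: "val (neg x) = 1 - val x"
  using val_bounds[of x] by (simp add: neg_unit_interval_def val_Unit)

lemma neg_antimono: "x \<le> y \<Longrightarrow> neg y \<le> neg x" for x y :: unit_interval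
  by (simp add: less_eq_unit_interval_def)

class pair_lattice = degree_lattice +
  fixes coords :: "'a \<Rightarrow> unit_interval \<times> unit_interval"

typedef LF = "{x. val (fst x) + val (snd x) \<le> 1}" morphisms pair_LF Abs_LF
  by (rule exI[of _ "(bot, bot)"]) (simp add: bot_unit_interval_def val_Unit)

typedef LV = "{x :: unit_interval \<times> unit_interval. fst x \<le> snd x}" morphisms pair_LV Abs_LV
  by (rule exI[of _ "(bot, bot)"]) simp

lemma LF_iff: "val x1 + val x2 \<le> 1 \<longleftrightarrow> x1 \<le> neg x2"
  by (auto simp: less_eq_unit_interval_def)

lemma pair_LF_le: "fst (pair_LF x) \<le> neg (snd (pair_LF x))"
  using pair_LF[of x] by (auto simp: LF_iff)

lemma pair_LF_Abs: "x1 \<le> neg x2 \<Longrightarrow> pair_LF (Abs_LF (x1, x2)) = (x1, x2)"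
  by (simp add: Abs_LF_inverse LF_iff)

lemma neg_neg_unit [simp]: "neg (neg x) = x" for x :: unit_interval
  by (simp add: val_inject[symmetric])

lemma le_neg_swap: "x \<le> neg y \<longleftrightarrow> y \<le> neg x" for x y :: unit_interval
  by (auto simp: less_eq_unit_interval_def)

lemma pair_LV_le: "fst (pair_LV x) \<le> snd (pair_LV x)"
  using pair_LV[of x] by auto

lemma pair_LV_Abs: "x1 \<le> x2 \<Longrightarrow> pair_LV (Abs_LV (x1, x2)) = (x1, x2)"
  by (simp add: Abs_LV_inverse)

instantiation LF :: complete_lattice
begin
definition "x \<le> y \<longleftrightarrow> fst (pair_LF x) \<le> fst (pair_LF y) \<and> snd (pair_LF y) \<le> snd (pair_LF x)"
definition "x < y \<longleftrightarrow> x \<le> y \<and> \<not> y \<le> x" for x y :: LF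
definition "bot = Abs_LF (bot, top)"
definition "top = Abs_LF (top, bot)"
definition "Inf A = Abs_LF (INF x\<in>A. fst (pair_LF x), SUP x\<in>A. snd (pair_LF x))"
definition "Sup A = Abs_LF (SUP x\<in>A. fst (pair_LF x), INF x\<in>A. snd (pair_LF x))"
definition "inf x y = Inf {x, y}" for x y :: LF
definition "sup x y = Sup {x, y}" for x y :: LF

instance
proof -
  have pI: "pair_LF (Inf A) = (INF x\<in>A. fst (pair_LF x), SUP x\<in>A. snd (pair_LF x))" for A
    unfolding Inf_LF_def
  proof (rule pair_LF_Abs, subst le_neg_swap, rule SUP_least)
    fix x assume "x \<in> A"
    then have "(INF x\<in>A. fst (pair_LF x)) \<le> fst (pair_LF x)" by (rule INF_lower)
    then show "snd (pair_LF x) \<le> neg (INF x\<in>A. fst (pair_LF x))"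
      using pair_LF_le[of x] by (subst le_neg_swap) (rule order_trans)
  qed
  have pS: "pair_LF (Sup A) = (SUP x\<in>A. fst (pair_LF x), INF x\<in>A. snd (pair_LF x))" for A
    unfolding Sup_LF_def
  proof (rule pair_LF_Abs, rule SUP_least)
    fix x assume "x \<in> A"
    then have "(INF x\<in>A. snd (pair_LF x)) \<le> snd (pair_LF x)" by (rule INF_lower)
    then show "fst (pair_LF x) \<le> neg (INF x\<in>A. snd (pair_LF x))"
      using pair_LF_le[of x] neg_antimono order_trans by blast
  qed
  have lower: "Inf A \<le> x" and upper: "x \<le> Sup A" if "x \<in> A" for A and x :: LF
    using that by (auto simp: less_eq_LF_def pI pS intro: INF_lower SUP_upper)
  have greatest: "z \<le> Inf A" if "\<And>x. x \<in> A \<Longrightarrow> z \<le> x" for A and z :: LF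
    using that by (auto simp: less_eq_LF_def pI intro!: INF_greatest SUP_least)
  have least: "Sup A \<le> z" if "\<And>x. x \<in> A \<Longrightarrow> x \<le> z" for A and z :: LF
    using that by (auto simp: less_eq_LF_def pS intro!: INF_greatest SUP_least)
  have anti: "x = y" if "x \<le> y" "y \<le> x" for x y :: LF
    using that by (auto simp: less_eq_LF_def pair_LF_inject[symmetric] intro: prod_eqI)
  have tr: "x \<le> z" if "x \<le> y" "y \<le> z" for x y z :: LF
    using that by (auto simp: less_eq_LF_def intro: order_trans)
  show "OFCLASS(LF, complete_lattice_class)"
  proof
    fix x y z :: LF and A :: "LF set"
    show "x < y \<longleftrightarrow> x \<le> y \<and> \<not> y \<le> x" by (simp add: less_LF_def)
    show "x \<le> x" by (simp add: less_eq_LF_def)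
    show "x \<le> y \<Longrightarrow> y \<le> z \<Longrightarrow> x \<le> z" by (rule tr)
    show "x \<le> y \<Longrightarrow> y \<le> x \<Longrightarrow> x = y" by (rule anti)
    show "inf x y \<le> x" "inf x y \<le> y" unfolding inf_LF_def by (auto intro: lower)
    show "x \<le> sup x y" "y \<le> sup x y" unfolding sup_LF_def by (auto intro: upper)
    show "x \<le> y \<Longrightarrow> x \<le> z \<Longrightarrow> x \<le> inf y z" unfolding inf_LF_def by (rule greatest) auto
    show "y \<le> x \<Longrightarrow> z \<le> x \<Longrightarrow> sup y z \<le> x" unfolding sup_LF_def by (rule least) auto
    show "x \<in> A \<Longrightarrow> Inf A \<le> x" by (rule lower)
    show "x \<in> A \<Longrightarrow> x \<le> Sup A" by (rule upper)
    show "(\<And>x. x \<in> A \<Longrightarrow> z \<le> x) \<Longrightarrow> z \<le> Inf A" by (rule greatest)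
    show "(\<And>x. x \<in> A \<Longrightarrow> x \<le> z) \<Longrightarrow> Sup A \<le> z" by (rule least)
    show "Inf {} = (top :: LF)" by (simp add: Inf_LF_def top_LF_def)
    show "Sup {} = (bot :: LF)" by (simp add: Sup_LF_def bot_LF_def)
  qed
qed
end

instantiation LV :: complete_lattice
begin
definition "x \<le> y \<longleftrightarrow> fst (pair_LV x) \<le> fst (pair_LV y) \<and> snd (pair_LV x) \<le> snd (pair_LV y)"
definition "x < y \<longleftrightarrow> x \<le> y \<and> \<not> y \<le> x" for x y :: LV
definition "bot = Abs_LV (bot, bot)"
definition "top = Abs_LV (top, top)"
definition "Inf A = Abs_LV (INF x\<in>A. fst (pair_LV x), INF x\<in>A. snd (pair_LV x))"
definition "Sup A = Abs_LV (SUP x\<in>A. fst (pair_LV x), SUP x\<in>A. snd (pair_LV x))"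
definition "inf x y = Inf {x, y}" for x y :: LV
definition "sup x y = Sup {x, y}" for x y :: LV

instance
proof -
  have pI: "pair_LV (Inf A) = (INF x\<in>A. fst (pair_LV x), INF x\<in>A. snd (pair_LV x))" for A
    unfolding Inf_LV_def by (rule pair_LV_Abs) (blast intro: INF_mono pair_LV_le)
  have pS: "pair_LV (Sup A) = (SUP x\<in>A. fst (pair_LV x), SUP x\<in>A. snd (pair_LV x))" for A
    unfolding Sup_LV_def by (rule pair_LV_Abs) (blast intro: SUP_mono pair_LV_le)
  have lower: "Inf A \<le> x" and upper: "x \<le> Sup A" if "x \<in> A" for A and x :: LV
    using that by (auto simp: less_eq_LV_def pI pS intro: INF_lower SUP_upper)
  have greatest: "z \<le> Inf A" if "\<And>x. x \<in> A \<Longrightarrow> z \<le> x" for A and z :: LV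
    using that by (auto simp: less_eq_LV_def pI intro!: INF_greatest)
  have least: "Sup A \<le> z" if "\<And>x. x \<in> A \<Longrightarrow> x \<le> z" for A and z :: LV
    using that by (auto simp: less_eq_LV_def pS intro!: SUP_least)
  have anti: "x = y" if "x \<le> y" "y \<le> x" for x y :: LV
    using that by (auto simp: less_eq_LV_def pair_LV_inject[symmetric] intro: prod_eqI)
  have tr: "x \<le> z" if "x \<le> y" "y \<le> z" for x y z :: LV
    using that by (auto simp: less_eq_LV_def intro: order_trans)
  show "OFCLASS(LV, complete_lattice_class)"
  proof
    fix x y z :: LV and A :: "LV set"
    show "x < y \<longleftrightarrow> x \<le> y \<and> \<not> y \<le> x" by (simp add: less_LV_def)
    show "x \<le> x" by (simp add: less_eq_LV_def)
    show "x \<le> y \<Longrightarrow> y \<le> z \<Longrightarrow> x \<le> z" by (rule tr)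
    show "x \<le> y \<Longrightarrow> y \<le> x \<Longrightarrow> x = y" by (rule anti)
    show "inf x y \<le> x" "inf x y \<le> y" unfolding inf_LV_def by (auto intro: lower)
    show "x \<le> sup x y" "y \<le> sup x y" unfolding sup_LV_def by (auto intro: upper)
    show "x \<le> y \<Longrightarrow> x \<le> z \<Longrightarrow> x \<le> inf y z" unfolding inf_LV_def by (rule greatest) auto
    show "y \<le> x \<Longrightarrow> z \<le> x \<Longrightarrow> sup y z \<le> x" unfolding sup_LV_def by (rule least) auto
    show "x \<in> A \<Longrightarrow> Inf A \<le> x" by (rule lower)
    show "x \<in> A \<Longrightarrow> x \<le> Sup A" by (rule upper)
    show "(\<And>x. x \<in> A \<Longrightarrow> z \<le> x) \<Longrightarrow> z \<le> Inf A" by (rule greatest)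
    show "(\<And>x. x \<in> A \<Longrightarrow> x \<le> z) \<Longrightarrow> Sup A \<le> z" by (rule least)
    show "Inf {} = (top :: LV)" by (simp add: Inf_LV_def top_LV_def)
    show "Sup {} = (bot :: LV)" by (simp add: Sup_LV_def bot_LV_def)
  qed
qed
end

instantiation LF :: pair_lattice
begin
definition "neg x = Abs_LF (snd (pair_LF x), fst (pair_LF x))"
definition "coords = pair_LF"
instance ..
end

instantiation LV :: pair_lattice
begin
definition "neg x = Abs_LV (neg (snd (pair_LV x)), neg (fst (pair_LV x)))"
definition "coords = pair_LV"
instance ..
end

lemma coords_LF_simps:
  fixes x :: LF
  shows "coords (neg x) = (snd (coords x), fst (coords x))"
    and "coords (bot :: LF) = (bot, top)" and "coords (top :: LF) = (top, bot)"
    and "(p \<in> range (coords :: LF \<Rightarrow> _)) \<longleftrightarrow> val (fst p) + val (snd p) \<le> 1"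
proof -
  show "coords (neg x) = (snd (coords x), fst (coords x))"
    using pair_LF_le[of x] le_neg_swap by (simp add: coords_LF_def neg_LF_def pair_LF_Abs)
  show "coords (bot :: LF) = (bot, top)" "coords (top :: LF) = (top, bot)"
    by (simp_all add: coords_LF_def bot_LF_def top_LF_def pair_LF_Abs le_neg_swap[of top])
  show "(p \<in> range (coords :: LF \<Rightarrow> _)) \<longleftrightarrow> val (fst p) + val (snd p) \<le> 1"
    using type_definition.Rep_range[OF type_definition_LF] by (simp add: coords_LF_def)
qed

lemma coords_LV_simps:
  fixes x :: LV
  shows "coords (neg x) = (neg (snd (coords x)), neg (fst (coords x)))"
    and "coords (bot :: LV) = (bot, bot)" and "coords (top :: LV) = (top, top)"
    and "(p \<in> range (coords :: LV \<Rightarrow> _)) \<longleftrightarrow> fst p \<le> snd p"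
proof -
  show "coords (neg x) = (neg (snd (coords x)), neg (fst (coords x)))"
    using pair_LV_le[of x] by (simp add: coords_LV_def neg_LV_def pair_LV_Abs neg_antimono)
  show "coords (bot :: LV) = (bot, bot)" "coords (top :: LV) = (top, top)"
    by (simp_all add: coords_LV_def bot_LV_def top_LV_def pair_LV_Abs)
  show "(p \<in> range (coords :: LV \<Rightarrow> _)) \<longleftrightarrow> fst p \<le> snd p"
    using type_definition.Rep_range[OF type_definition_LV] by (simp add: coords_LV_def)
qed

datatype ('c, 'v) trm = Var 'v | Const 'c

text \<open>Ground atoms, literals and rules are those whose arguments have the type \<open>'c\<close> of
  constants instead of \<open>('c, 'v) trm\<close>.\<close>

datatype ('p, 't) atom = Atom (pred: 'p) (args: "'t list")

datatype ('p, 't) literal = Pos (atom_of: "('p, 't) atom") | Neg (atom_of: "('p, 't) atom")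

datatype ('p, 't, 'l, 'i) rule =
  Rule (head: "('p, 't) atom") (body: "('p, 't) literal list") (level: 'l) (impl: 'i)

type_synonym 'l implication = "'l \<Rightarrow> 'l \<Rightarrow> 'l"

type_synonym ('p, 'c, 'v, 'l, 'i) program = "('p, ('c, 'v) trm, 'l, 'i) rule set"

type_synonym ('p, 'c, 'v, 'l) lattice_program = "('p, 'c, 'v, 'l, 'l implication) program"

type_synonym ('p, 'c, 'v, 'l) bipolar_program =
  "('p, 'c, 'v, 'l, unit_interval implication \<times> unit_interval implication) program"

definition rule_atoms :: "('p, 't, 'l, 'i) rule \<Rightarrow> ('p, 't) atom set" where
  "rule_atoms r = insert (head r) (atom_of ` set (body r))"

definition atom_vars :: "('p, ('c, 'v) trm) atom \<Rightarrow> 'v set" where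
  "atom_vars A = {x. Var x \<in> set (args A)}"

definition rule_vars :: "('p, ('c, 'v) trm, 'l, 'i) rule \<Rightarrow> 'v set" where
  "rule_vars r = (\<Union>A\<in>rule_atoms r. atom_vars A)"

definition preds :: "('p, 'c, 'v, 'l, 'i) program \<Rightarrow> 'p set" where
  "preds P = (\<Union>r\<in>P. pred ` rule_atoms r)"

definition constants :: "('p, 'c, 'v, 'l, 'i) program \<Rightarrow> 'c set" where
  "constants P = {c. \<exists>r\<in>P. \<exists>A\<in>rule_atoms r. Const c \<in> set (args A)}"

definition safe :: "('p, ('c, 'v) trm, 'l, 'i) rule \<Rightarrow> bool" where
  "safe r \<longleftrightarrow>
     atom_vars (head r) \<subseteq> (\<Union>A\<in>set (body r). atom_vars (atom_of A)) \<and>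
     (\<forall>A. Neg A \<in> set (body r) \<longrightarrow> atom_vars A \<subseteq> (\<Union>B\<in>{B. Pos B \<in> set (body r)}. atom_vars B))"

definition positive :: "('p, 'c, 'v, 'l, 'i) program \<Rightarrow> bool" where
  "positive P \<longleftrightarrow> (\<forall>r\<in>P. \<forall>A\<in>set (body r). is_Pos A)"

definition implication_operator :: "'l::complete_lattice implication \<Rightarrow> bool" where
  "implication_operator I \<longleftrightarrow>
     (\<forall>\<alpha> \<alpha>' \<gamma>. \<alpha> \<le> \<alpha>' \<longrightarrow> I \<alpha>' \<gamma> \<le> I \<alpha> \<gamma>) \<and>
     (\<forall>\<alpha> \<gamma> \<gamma>'. \<gamma> \<le> \<gamma>' \<longrightarrow> I \<alpha> \<gamma> \<le> I \<alpha> \<gamma>') \<and>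
     I bot bot = top \<and> I bot top = top \<and> I top bot = bot \<and> I top top = top"

definition has_minimum :: "'l::order set \<Rightarrow> bool" where
  "has_minimum A \<longleftrightarrow> (\<exists>m\<in>A. \<forall>x\<in>A. m \<le> x)"

text \<open>\<open>min_level I \<beta> \<alpha>\<close> is only meaningful when the minimum exists.\<close>

definition min_level :: "'l::order implication \<Rightarrow> 'l \<Rightarrow> 'l \<Rightarrow> 'l" where
  "min_level I \<beta> \<alpha> = (LEAST \<gamma>. \<beta> \<le> I \<alpha> \<gamma>)"

definition min_level_exists :: "'l::order implication \<Rightarrow> 'l \<Rightarrow> bool" where
  "min_level_exists I \<beta> \<longleftrightarrow> (\<forall>\<alpha>. has_minimum {\<gamma>. \<beta> \<le> I \<alpha> \<gamma>})"

text \<open>A head-level function maps implication, rule level and the list of levels of the body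
  literals to the level of the head. The level of a fact is the level of the rule itself.\<close>

type_synonym ('l, 'i) head_level_fun = "'i \<Rightarrow> 'l \<Rightarrow> 'l list \<Rightarrow> 'l"

definition lattice_head_level :: "('l::complete_lattice, 'l implication) head_level_fun" where
  "lattice_head_level I \<beta> ls = (if ls = [] then \<beta> else min_level I \<beta> (Inf (set ls)))"

definition lattice_admissible :: "('p, 't, 'l::complete_lattice, 'l implication) rule \<Rightarrow> bool" where
  "lattice_admissible r \<longleftrightarrow>
     implication_operator (impl r) \<and> (body r \<noteq> [] \<longrightarrow> min_level_exists (impl r) (level r))"

text \<open>In the bipolar case the coordinates are computed separately, so the resulting pair need not
  lie in the lattice; that it does is part of admissibility.\<close>

datatype variant = Variant_a | Variant_b

definition bipolar_pair :: "variant \<Rightarrow> unit_interval implication \<times> unit_interval implication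
    \<Rightarrow> 'l::pair_lattice \<Rightarrow> 'l list \<Rightarrow> unit_interval \<times> unit_interval" where
  "bipolar_pair v I \<beta> ls =
     (min_level (fst I) (fst (coords \<beta>)) (Min ((\<lambda>l. fst (coords l)) ` set ls)),
      case v of
        Variant_a \<Rightarrow> min_level (snd I) (snd (coords \<beta>)) (Min ((\<lambda>l. snd (coords l)) ` set ls))
      | Variant_b \<Rightarrow>
          neg (min_level (snd I) (neg (snd (coords \<beta>))) (Min ((\<lambda>l. neg (snd (coords l))) ` set ls))))"

definition bipolar_head_level :: "variant \<Rightarrow>
    ('l::pair_lattice, unit_interval implication \<times> unit_interval implication) head_level_fun" where
  "bipolar_head_level v I \<beta> ls =
     (if ls = [] then \<beta> else (THE l. coords l = bipolar_pair v I \<beta> ls))"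

definition bipolar_admissible :: "variant \<Rightarrow>
    ('p, 't, 'l::pair_lattice, unit_interval implication \<times> unit_interval implication) rule \<Rightarrow> bool" where
  "bipolar_admissible v r \<longleftrightarrow>
     implication_operator (fst (impl r)) \<and> implication_operator (snd (impl r)) \<and>
     (body r \<noteq> [] \<longrightarrow>
        min_level_exists (fst (impl r)) (fst (coords (level r))) \<and>
        min_level_exists (snd (impl r))
          (case v of Variant_a \<Rightarrow> snd (coords (level r)) | Variant_b \<Rightarrow> neg (snd (coords (level r)))) \<and>
        (\<forall>ls :: 'l list. length ls = length (body r) \<longrightarrow>
           bipolar_pair v (impl r) (level r) ls \<in> range (coords :: 'l \<Rightarrow> _)))"

definition datalog_program ::
    "('p \<Rightarrow> nat) \<Rightarrow> (('p, ('c, 'v) trm, 'l, 'i) rule \<Rightarrow> bool) \<Rightarrow> ('p, 'c, 'v, 'l, 'i) program \<Rightarrow> bool" where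
  "datalog_program arity admissible P \<longleftrightarrow>
     finite P \<and>
     (\<forall>r\<in>P. safe r \<and> admissible r \<and> (\<forall>A\<in>rule_atoms r. length (args A) = arity (pred A)))"

definition proximity :: "'d set \<Rightarrow> ('d \<Rightarrow> 'd \<Rightarrow> 'l::complete_lattice) \<Rightarrow> bool" where
  "proximity D R \<longleftrightarrow> (\<forall>x\<in>D. R x x = top) \<and> (\<forall>x\<in>D. \<forall>y\<in>D. R x y = R y x)"

text \<open>For \<open>d \<in> D\<close> this is the proximity set of \<open>d\<close>; any other element is close only to itself.\<close>

definition proximity_set :: "'d set \<Rightarrow> ('d \<Rightarrow> 'd \<Rightarrow> 'l::complete_lattice) \<Rightarrow> 'd \<Rightarrow> ('d \<times> 'l) set" where
  "proximity_set D R d = (if d \<in> D then {(d', R d d') |d'. d' \<in> D} else {(d, top)})"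

record ('p, 'c, 'l) background =
  bk_terms :: "'c set"
  bk_term_prox :: "'c \<Rightarrow> 'c \<Rightarrow> 'l"
  bk_preds :: "'p set"
  bk_pred_prox :: "'p \<Rightarrow> 'p \<Rightarrow> 'l"

definition background_knowledge :: "('p, 'c, 'l::complete_lattice) background \<Rightarrow> bool" where
  "background_knowledge Bk \<longleftrightarrow>
     proximity (bk_terms Bk) (bk_term_prox Bk) \<and> proximity (bk_preds Bk) (bk_pred_prox Bk)"

abbreviation RG :: "('p, 'c, 'l::complete_lattice) background \<Rightarrow> 'c \<Rightarrow> ('c \<times> 'l) set" where
  "RG Bk \<equiv> proximity_set (bk_terms Bk) (bk_term_prox Bk)"

abbreviation RS :: "('p, 'c, 'l::complete_lattice) background \<Rightarrow> 'p \<Rightarrow> ('p \<times> 'l) set" where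
  "RS Bk \<equiv> proximity_set (bk_preds Bk) (bk_pred_prox Bk)"

text \<open>The uncertainty function of an \<open>n\<close>-ary predicate takes its last \<open>n\<close> arguments as a list.\<close>

type_synonym ('p, 'l) uncertainty_funs = "'p \<Rightarrow> 'l \<Rightarrow> 'l \<Rightarrow> 'l list \<Rightarrow> 'l"

definition uncertainty_function :: "nat \<Rightarrow> ('l::complete_lattice \<Rightarrow> 'l \<Rightarrow> 'l list \<Rightarrow> 'l) \<Rightarrow> bool" where
  "uncertainty_function n f \<longleftrightarrow>
     (\<forall>\<alpha> \<alpha>' \<mu> \<mu>' ls ls'. length ls = n \<and> \<alpha> \<le> \<alpha>' \<and> \<mu> \<le> \<mu>' \<and> list_all2 (\<le>) ls ls'
        \<longrightarrow> f \<alpha> \<mu> ls \<le> f \<alpha>' \<mu>' ls') \<and>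
     (\<forall>\<alpha> \<mu> ls. length ls = n \<longrightarrow> f \<alpha> \<mu> ls \<le> Inf (set (\<alpha> # \<mu> # ls))) \<and>
     (\<forall>\<alpha>. f \<alpha> top (replicate n top) = \<alpha>)"

definition function_set :: "('p \<Rightarrow> nat) \<Rightarrow> ('p, 'c, 'v, 'l::complete_lattice, 'i) program
    \<Rightarrow> ('p, 'l) uncertainty_funs \<Rightarrow> bool" where
  "function_set arity P \<Phi> \<longleftrightarrow> (\<forall>p\<in>preds P. uncertainty_function (arity p) (\<Phi> p))"

definition modH :: "('p, 'c, 'v, 'l, 'i) program \<Rightarrow> ('p, 'c, 'l) background \<Rightarrow> 'c set" where
  "modH P Bk = constants P \<union> bk_terms Bk"

definition modB :: "('p \<Rightarrow> nat) \<Rightarrow> ('p, 'c, 'v, 'l, 'i) program \<Rightarrow> ('p, 'c, 'l) background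
    \<Rightarrow> ('p, 'c) atom set" where
  "modB arity P Bk =
     {Atom q ss |q ss. q \<in> preds P \<union> bk_preds Bk \<and> length ss = arity q \<and> set ss \<subseteq> modH P Bk}"

text \<open>Fuzzy sets over \<open>B\<close> are represented as total functions that are \<open>bot\<close> outside \<open>B\<close>, so that
  their order and join are those of the function space.\<close>

definition FV :: "'a set \<Rightarrow> ('a \<Rightarrow> 'l::complete_lattice) set" where
  "FV B = {X. \<forall>a. a \<notin> B \<longrightarrow> X a = bot}"

definition fuzzy_set_of :: "('a \<times> 'l) set \<Rightarrow> 'a \<Rightarrow> 'l::complete_lattice" where
  "fuzzy_set_of C a = Sup {l. (a, l) \<in> C}"

fun inst_trm :: "('v \<Rightarrow> 'c) \<Rightarrow> ('c, 'v) trm \<Rightarrow> 'c" where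
  "inst_trm \<sigma> (Var x) = \<sigma> x"
| "inst_trm \<sigma> (Const c) = c"

fun inst_atom :: "('v \<Rightarrow> 'c) \<Rightarrow> ('p, ('c, 'v) trm) atom \<Rightarrow> ('p, 'c) atom" where
  "inst_atom \<sigma> (Atom p ts) = Atom p (map (inst_trm \<sigma>) ts)"

fun inst_literal :: "('v \<Rightarrow> 'c) \<Rightarrow> ('p, ('c, 'v) trm) literal \<Rightarrow> ('p, 'c) literal" where
  "inst_literal \<sigma> (Pos A) = Pos (inst_atom \<sigma> A)"
| "inst_literal \<sigma> (Neg A) = Neg (inst_atom \<sigma> A)"

fun inst_rule :: "('v \<Rightarrow> 'c) \<Rightarrow> ('p, ('c, 'v) trm, 'l, 'i) rule \<Rightarrow> ('p, 'c, 'l, 'i) rule" where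
  "inst_rule \<sigma> (Rule A As \<beta> I) = Rule (inst_atom \<sigma> A) (map (inst_literal \<sigma>) As) \<beta> I"

definition ground :: "('p, 'c, 'v, 'l, 'i) program \<Rightarrow> ('p, 'c, 'l) background
    \<Rightarrow> ('p, 'c, 'l, 'i) rule set" where
  "ground P Bk = {inst_rule \<sigma> r |\<sigma> r. r \<in> P \<and> \<sigma> ` rule_vars r \<subseteq> modH P Bk}"

fun literal_level :: "(('p, 'c) atom \<Rightarrow> 'l::degree_lattice) \<Rightarrow> ('p, 'c) literal \<Rightarrow> 'l" where
  "literal_level X (Pos A) = X A"
| "literal_level X (Neg A) = neg (X A)"

text \<open>The condition \<open>arity q = arity p\<close> ensures that \<open>q(s\<^sub>1,\<dots>,s\<^sub>n)\<close> is an atom.\<close>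

definition consequences :: "('p \<Rightarrow> nat) \<Rightarrow> ('l::degree_lattice, 'i) head_level_fun
    \<Rightarrow> ('p, 'c, 'l) background \<Rightarrow> ('p, 'l) uncertainty_funs \<Rightarrow> ('p, 'c, 'l, 'i) rule
    \<Rightarrow> (('p, 'c) atom \<Rightarrow> 'l) \<Rightarrow> (('p, 'c) atom \<times> 'l) set" where
  "consequences arity head_level Bk \<Phi> r X =
     (let p = pred (head r); ts = args (head r);
          \<alpha> = head_level (impl r) (level r) (map (literal_level X) (body r))
      in {(Atom q ss, \<Phi> p \<alpha> \<mu> ls) |q ss \<mu> ls.
            arity q = arity p \<and> (q, \<mu>) \<in> RS Bk p \<and>
            length ss = length ts \<and> length ls = length ts \<and>
            (\<forall>i<length ts. (ss ! i, ls ! i) \<in> RG Bk (ts ! i))})"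

definition modNT :: "('p \<Rightarrow> nat) \<Rightarrow> ('l::degree_lattice, 'i) head_level_fun
    \<Rightarrow> ('p, 'c, 'l) background \<Rightarrow> ('p, 'l) uncertainty_funs \<Rightarrow> ('p, 'c, 'l, 'i) rule
    \<Rightarrow> (('p, 'c) atom \<Rightarrow> 'l) \<Rightarrow> ('p, 'c) atom \<Rightarrow> 'l" where
  "modNT arity head_level Bk \<Phi> r X = sup (fuzzy_set_of (consequences arity head_level Bk \<Phi> r X)) X"

definition modNT_fixpoint :: "('p \<Rightarrow> nat) \<Rightarrow> ('l::degree_lattice, 'i) head_level_fun
    \<Rightarrow> ('p, 'c, 'v, 'l, 'i) program \<Rightarrow> ('p, 'c, 'l) background \<Rightarrow> ('p, 'l) uncertainty_funs
    \<Rightarrow> (('p, 'c) atom \<Rightarrow> 'l) \<Rightarrow> bool" where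
  "modNT_fixpoint arity head_level P Bk \<Phi> X \<longleftrightarrow>
     X \<in> FV (modB arity P Bk) \<and> (\<forall>r\<in>ground P Bk. modNT arity head_level Bk \<Phi> r X = X)"

definition modNT_least_fixpoint :: "('p \<Rightarrow> nat) \<Rightarrow> ('l::degree_lattice, 'i) head_level_fun
    \<Rightarrow> ('p, 'c, 'v, 'l, 'i) program \<Rightarrow> ('p, 'c, 'l) background \<Rightarrow> ('p, 'l) uncertainty_funs
    \<Rightarrow> (('p, 'c) atom \<Rightarrow> 'l) \<Rightarrow> bool" where
  "modNT_least_fixpoint arity head_level P Bk \<Phi> X \<longleftrightarrow>
     modNT_fixpoint arity head_level P Bk \<Phi> X \<and>
     (\<forall>Y. modNT_fixpoint arity head_level P Bk \<Phi> Y \<longrightarrow> X \<le> Y)"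

end

theory Submission
  imports Defs
begin

text \<open>A fuzzy set is a fixed point iff it dominates every consequence of every ground rule. The fuzzy
  set with level \<open>top\<close> on all of \<open>modB\<close> does, because consequences stay inside \<open>modB\<close>; negation plays
  no role here. For a positive program the consequences grow with the fuzzy set, since decreasing the
  body level enlarges \<open>{\<gamma>. \<beta> \<le> I \<alpha> \<gamma>}\<close>; so the pointwise infimum of all fixed points again
  dominates its consequences (Knaster--Tarski).\<close>

section \<open>Closure under consequences and existence of a fixed point\<close>

lemma modNT_eq_iff:
  "modNT arity hl Bk \<Phi> r X = X \<longleftrightarrow> (\<forall>(a, l)\<in>consequences arity hl Bk \<Phi> r X. l \<le> X a)"
proof -
  have "modNT arity hl Bk \<Phi> r X = X \<longleftrightarrow> fuzzy_set_of (consequences arity hl Bk \<Phi> r X) \<le> X"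
    by (simp add: modNT_def le_iff_sup)
  also have "\<dots> \<longleftrightarrow> (\<forall>(a, l)\<in>consequences arity hl Bk \<Phi> r X. l \<le> X a)"
    by (auto simp: le_fun_def fuzzy_set_of_def Sup_le_iff)
  finally show ?thesis .
qed

lemma inst_rule_sel [simp]:
  "head (inst_rule \<sigma> r) = inst_atom \<sigma> (head r)"
  "body (inst_rule \<sigma> r) = map (inst_literal \<sigma>) (body r)"
  "level (inst_rule \<sigma> r) = level r"
  "impl (inst_rule \<sigma> r) = impl r"
  by (cases r; simp)+

lemma inst_atom_sel [simp]:
  "pred (inst_atom \<sigma> A) = pred A"
  "args (inst_atom \<sigma> A) = map (inst_trm \<sigma>) (args A)"
  by (cases A; simp)+

text \<open>The case \<open>d' = d\<close> accounts for elements outside \<open>D\<close>, whose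
  proximity set is a singleton.\<close>

lemma proximity_set_memD: "(d', l) \<in> proximity_set D R d \<Longrightarrow> d' = d \<or> d' \<in> D"
  by (auto simp: proximity_set_def split: if_splits)

lemma inst_head_args_subset:
  assumes "r \<in> P" and "\<sigma> ` rule_vars r \<subseteq> modH P Bk"
  shows "set (args (inst_atom \<sigma> (head r))) \<subseteq> modH P Bk"
proof -
  have "inst_trm \<sigma> t \<in> modH P Bk" if t: "t \<in> set (args (head r))" for t
  proof (cases t)
    case (Var x)
    then have "x \<in> rule_vars r"
      using t by (auto simp: rule_vars_def rule_atoms_def atom_vars_def)
    then show ?thesis
      using Var assms(2) by auto
  next
    case (Const c)
    then have "c \<in> constants P"
      using t assms(1) by (auto simp: constants_def rule_atoms_def)
    then show ?thesis
      using Const by (simp add: modH_def)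
  qed
  then show ?thesis
    by auto
qed

text \<open>Proximity replaces a head predicate or argument by itself or by an element of the
  background knowledge, and \<open>modB\<close> admits both. The arity fits because
  \<open>consequences\<close> only lets in \<open>q\<close> with the arity of the head
  predicate.\<close>

lemma consequences_in_modB:
  assumes P: "datalog_program arity adm P" and r: "r \<in> ground P Bk"
    and al: "(a, l) \<in> consequences arity hl Bk \<Phi> r X"
  shows "a \<in> modB arity P Bk"
proof -
  obtain \<sigma> r0 where r0: "r = inst_rule \<sigma> r0" "r0 \<in> P" "\<sigma> ` rule_vars r0 \<subseteq> modH P Bk"
    using r by (auto simp: ground_def)
  let ?ts = "args (head r)"
  obtain q ss \<mu> ls where a: "a = Atom q ss" "arity q = arity (pred (head r))"
      "(q, \<mu>) \<in> RS Bk (pred (head r))" "length ss = length ?ts"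
      "\<forall>i<length ?ts. (ss ! i, ls ! i) \<in> RG Bk (?ts ! i)"
    using al by (auto simp: consequences_def Let_def)
  have len: "length ?ts = arity (pred (head r))"
    using P r0 by (auto simp: datalog_program_def rule_atoms_def)
  have "pred (head r) \<in> preds P"
    using r0 by (auto simp: preds_def rule_atoms_def)
  then have q: "q \<in> preds P \<union> bk_preds Bk"
    using proximity_set_memD[OF a(3)] by auto
  have ts: "set ?ts \<subseteq> modH P Bk"
    using inst_head_args_subset[OF r0(2,3)] r0(1) by simp
  have "ss ! i \<in> modH P Bk" if i: "i < length ss" for i
  proof -
    have "ss ! i = ?ts ! i \<or> ss ! i \<in> bk_terms Bk"
      using a(4,5) i by (auto dest: proximity_set_memD)
    then show ?thesis
      using ts i a(4) by (auto simp: modH_def dest: nth_mem)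
  qed
  then have "set ss \<subseteq> modH P Bk"
    by (auto simp: in_set_conv_nth)
  then show ?thesis
    using a len q by (auto simp: modB_def)
qed

lemma modNT_fixpoint_top:
  assumes "datalog_program arity adm P"
  shows "modNT_fixpoint arity hl P Bk \<Phi> (\<lambda>a. if a \<in> modB arity P Bk then top else bot)"
  using consequences_in_modB[OF assms]
  by (fastforce simp: modNT_fixpoint_def FV_def modNT_eq_iff)

section \<open>Monotone consequences and the least fixed point\<close>

text \<open>All that the least fixed point requires of a program class. Only lists as long as the
  body are compared, since admissibility puts bipolar pairs into the lattice for this length
  only.\<close>

definition head_level_mono :: "('l::complete_lattice, 'i) head_level_fun \<Rightarrow> ('p, 't, 'l, 'i) rule \<Rightarrow> bool" where
  "head_level_mono hl r \<longleftrightarrow>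
     (\<forall>ls ls'. length ls = length (body r) \<and> list_all2 (\<le>) ls ls'
        \<longrightarrow> hl (impl r) (level r) ls \<le> hl (impl r) (level r) ls')"

text \<open>The choices of \<open>q\<close>, \<open>ss\<close>, \<open>\<mu>\<close> and
  \<open>ls\<close> do not depend on the fuzzy set, so they yield the same atom for
  \<open>Y\<close>; only the head level changes, and it grows.\<close>

lemma consequences_mono:
  assumes P: "datalog_program arity adm P" and \<Phi>: "function_set arity P \<Phi>" and pos: "positive P"
    and mono: "\<And>r. r \<in> P \<Longrightarrow> head_level_mono hl r"
    and r: "r \<in> ground P Bk" and XY: "X \<le> Y"
    and al: "(a, l) \<in> consequences arity hl Bk \<Phi> r X"
  shows "\<exists>l'\<ge>l. (a, l') \<in> consequences arity hl Bk \<Phi> r Y"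
proof -
  obtain \<sigma> r0 where r0: "r = inst_rule \<sigma> r0" "r0 \<in> P"
    using r by (auto simp: ground_def)
  let ?p = "pred (head r)"
  let ?\<alpha> = "\<lambda>X. hl (impl r) (level r) (map (literal_level X) (body r))"
  obtain q ss \<mu> ls where a: "a = Atom q ss" "l = \<Phi> ?p (?\<alpha> X) \<mu> ls" "arity q = arity ?p"
      "(q, \<mu>) \<in> RS Bk ?p" "length ss = length (args (head r))" "length ls = length (args (head r))"
      "\<forall>i<length (args (head r)). (ss ! i, ls ! i) \<in> RG Bk (args (head r) ! i)"
    using al by (auto simp: consequences_def Let_def)
  \<comment> \<open>Instantiation preserves the sign of a literal, so a ground body has no negated
    levels, which would decrease.\<close>
  have "literal_level X A \<le> literal_level Y A" if A: "A \<in> set (body r)" for A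
  proof -
    obtain B where B: "B \<in> set (body r0)" "A = inst_literal \<sigma> B"
      using A r0(1) by auto
    then have "is_Pos B"
      using pos r0(2) by (simp add: positive_def)
    then have "is_Pos A"
      unfolding B(2) by (cases B) simp_all
    then show ?thesis
      using XY by (cases A) (auto simp: le_fun_def)
  qed
  then have "list_all2 (\<le>) (map (literal_level X) (body r)) (map (literal_level Y) (body r))"
    by (auto simp: list_all2_conv_all_nth)
  then have "?\<alpha> X \<le> ?\<alpha> Y"
    using mono[OF r0(2)] r0(1) by (simp add: head_level_mono_def)
  moreover have "?p \<in> preds P"
    using r0 by (auto simp: preds_def rule_atoms_def)
  then have "uncertainty_function (arity ?p) (\<Phi> ?p)"
    using \<Phi> by (simp add: function_set_def)
  moreover have "length ls = arity ?p"
    using P r0 a(6) by (auto simp: datalog_program_def rule_atoms_def)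
  moreover have "list_all2 (\<le>) ls ls"
    by (simp add: list_all2_refl)
  ultimately have "l \<le> \<Phi> ?p (?\<alpha> Y) \<mu> ls"
    unfolding a(2) uncertainty_function_def by (meson order_refl)
  moreover have "(a, \<Phi> ?p (?\<alpha> Y) \<mu> ls) \<in> consequences arity hl Bk \<Phi> r Y"
    using a unfolding consequences_def Let_def by blast
  ultimately show ?thesis
    by blast
qed

text \<open>Each ground rule has its own operator, so the infimum is taken over their common fixed
  points. Being a lower bound is built in; what remains is that the infimum is itself such a fixed
  point.\<close>

lemma modNT_least_fixpoint_Inf:
  assumes P: "datalog_program arity adm P" and \<Phi>: "function_set arity P \<Phi>" and pos: "positive P"
    and mono: "\<And>r. r \<in> P \<Longrightarrow> head_level_mono hl r"
  shows "modNT_least_fixpoint arity hl P Bk \<Phi> (Inf (Collect (modNT_fixpoint arity hl P Bk \<Phi>)))"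
    (is "modNT_least_fixpoint _ _ _ _ _ (Inf ?F)")
proof -
  have lower: "Inf ?F \<le> Y" if "modNT_fixpoint arity hl P Bk \<Phi> Y" for Y
    using that by (auto intro: Inf_lower)
  \<comment> \<open>The fixed point that is \<open>top\<close> on \<open>modB\<close> belongs to the
    family and is \<open>bot\<close> outside. Over an empty family the infimum would be
    \<open>top\<close> everywhere.\<close>
  have "Inf ?F a = bot" if "a \<notin> modB arity P Bk" for a
    using le_funD[OF lower[OF modNT_fixpoint_top[OF P, of hl Bk \<Phi>]], of a] that
    by (simp only: if_False bot_unique)
  then have "Inf ?F \<in> FV (modB arity P Bk)"
    by (simp add: FV_def)
  moreover have "modNT arity hl Bk \<Phi> r (Inf ?F) = Inf ?F" if r: "r \<in> ground P Bk" for r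
    unfolding modNT_eq_iff
  proof (intro ballI, clarify)
    fix a l
    assume al: "(a, l) \<in> consequences arity hl Bk \<Phi> r (Inf ?F)"
    \<comment> \<open>Passing from the infimum up to \<open>Y\<close> can only raise the level to
      some \<open>l'\<close>, which the fixed point \<open>Y\<close> already dominates.\<close>
    have "l \<le> Y a" if Y: "Y \<in> ?F" for Y
    proof -
      have "Inf ?F \<le> Y"
        using lower Y by simp
      from consequences_mono[OF P \<Phi> pos mono r this al]
      obtain l' where "l \<le> l'" "(a, l') \<in> consequences arity hl Bk \<Phi> r Y"
        by blast
      moreover have "modNT arity hl Bk \<Phi> r Y = Y"
        using Y r by (simp add: modNT_fixpoint_def)
      ultimately show ?thesis
        unfolding modNT_eq_iff using order_trans by fastforce
    qed
    then show "l \<le> (Inf ?F) a"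
      by (auto intro: INF_greatest)
  qed
  ultimately show ?thesis
    using lower by (auto simp: modNT_least_fixpoint_def modNT_fixpoint_def)
qed

text \<open>Common interface for all program classes: each one only has to derive
  \<open>head_level_mono\<close> from its notion of admissibility.\<close>

lemma fixpoint_and_least_fixpoint:
  assumes "datalog_program arity adm P" and "function_set arity P \<Phi>"
    and "\<And>r. adm r \<Longrightarrow> head_level_mono hl r"
  shows "(\<exists>X. modNT_fixpoint arity hl P Bk \<Phi> X) \<and>
    (positive P \<longrightarrow> (\<exists>X. modNT_least_fixpoint arity hl P Bk \<Phi> X))"
proof -
  have "head_level_mono hl r" if "r \<in> P" for r
    using assms(1,3) that by (simp add: datalog_program_def)
  then show ?thesis
    using modNT_fixpoint_top[OF assms(1)] modNT_least_fixpoint_Inf[OF assms(1,2)] by blast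
qed

section \<open>Monotone head levels in the lattice case\<close>

text \<open>The minimum at \<open>\<alpha>'\<close> also solves the inequality at
  \<open>\<alpha>\<close>, because \<open>I\<close> decreases in its first argument.\<close>

lemma min_level_mono:
  fixes I :: "'l::complete_lattice implication"
  assumes I: "implication_operator I" and ex: "min_level_exists I \<beta>" and le: "\<alpha> \<le> \<alpha>'"
  shows "min_level I \<beta> \<alpha> \<le> min_level I \<beta> \<alpha>'"
proof -
  \<comment> \<open>Existence of the minimum makes \<open>LEAST\<close> an attained lower bound of
    the solutions.\<close>
  have min: "\<beta> \<le> I a (min_level I \<beta> a) \<and> (\<forall>\<gamma>. \<beta> \<le> I a \<gamma> \<longrightarrow> min_level I \<beta> a \<le> \<gamma>)" for a
  proof -
    obtain m where m: "\<beta> \<le> I a m" "\<And>\<gamma>. \<beta> \<le> I a \<gamma> \<Longrightarrow> m \<le> \<gamma>"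
      using ex by (auto simp: min_level_exists_def has_minimum_def)
    then have "min_level I \<beta> a = m"
      unfolding min_level_def by (rule Least_equality)
    then show ?thesis
      using m by simp
  qed
  have "\<beta> \<le> I \<alpha>' (min_level I \<beta> \<alpha>')"
    using min by blast
  also have "\<dots> \<le> I \<alpha> (min_level I \<beta> \<alpha>')"
    using I le by (simp add: implication_operator_def)
  finally show ?thesis
    using min by blast
qed

lemma lattice_head_level_mono:
  fixes r :: "('p, 't, 'l::complete_lattice, 'l implication) rule"
  assumes "lattice_admissible r"
  shows "head_level_mono lattice_head_level r"
  unfolding head_level_mono_def
proof (intro allI impI, elim conjE)
  fix ls ls' :: "'l list"
  assume len: "length ls = length (body r)" and le: "list_all2 (\<le>) ls ls'"
  show "lattice_head_level (impl r) (level r) ls \<le> lattice_head_level (impl r) (level r) ls'"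
  proof (cases "ls = []")
    \<comment> \<open>The case of a fact: both lists are empty and both head levels equal the rule
      level.\<close>
    case True
    then show ?thesis
      using le by simp
  next
    case False
    have "Inf (set ls) \<le> Inf (set ls')"
      using le by (intro Inf_mono) (fastforce simp: list_all2_conv_all_nth in_set_conv_nth)
    moreover have "ls' \<noteq> []" "body r \<noteq> []"
      using le len False by auto
    ultimately show ?thesis
      using assms False min_level_mono by (auto simp: lattice_head_level_def lattice_admissible_def)
  qed
qed

section \<open>Monotone head levels in the bipolar case\<close>

text \<open>Comparing through \<open>f\<close> serves the coordinate projections and the negated
  second coordinate alike.\<close>

lemma Min_image_mono_list:
  fixes f :: "'a \<Rightarrow> 'b::linorder"
  assumes "ls \<noteq> []" and "list_all2 (\<lambda>x y. f x \<le> f y) ls ls'"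
  shows "Min (f ` set ls) \<le> Min (f ` set ls')"
proof -
  have "ls' \<noteq> []"
    using assms by auto
  moreover have "\<exists>x\<in>set ls. f x \<le> f y" if "y \<in> set ls'" for y
    using assms(2) that by (fastforce simp: list_all2_conv_all_nth in_set_conv_nth)
  ultimately show ?thesis
    using assms(1) by (simp add: Min_le_iff)
qed

text \<open>Each coordinate of the head depends only on the same coordinate of the body levels. The
  two claims on the second coordinate serve the two lattices: \<open>LF\<close> reverses its order,
  \<open>LV\<close> keeps it.\<close>

lemma bipolar_pair_mono:
  fixes r :: "('p, 't, 'l::pair_lattice, unit_interval implication \<times> unit_interval implication) rule"
  assumes r: "bipolar_admissible v r" and len: "length ls = length (body r)" and ne: "ls \<noteq> []"
  shows bipolar_pair_mono_fst: "list_all2 (\<lambda>x y. fst (coords x) \<le> fst (coords y)) ls ls' \<Longrightarrow>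
      fst (bipolar_pair v (impl r) (level r) ls) \<le> fst (bipolar_pair v (impl r) (level r) ls')"
    and bipolar_pair_mono_snd: "list_all2 (\<lambda>x y. snd (coords x) \<le> snd (coords y)) ls ls' \<Longrightarrow>
      snd (bipolar_pair v (impl r) (level r) ls) \<le> snd (bipolar_pair v (impl r) (level r) ls')"
    and bipolar_pair_antimono_snd: "list_all2 (\<lambda>x y. snd (coords y) \<le> snd (coords x)) ls ls' \<Longrightarrow>
      snd (bipolar_pair v (impl r) (level r) ls') \<le> snd (bipolar_pair v (impl r) (level r) ls)"
proof -
  have b: "body r \<noteq> []"
    using len ne by auto
  have I: "implication_operator (fst (impl r))" "implication_operator (snd (impl r))"
      "min_level_exists (fst (impl r)) (fst (coords (level r)))"
      "min_level_exists (snd (impl r))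
         (case v of Variant_a \<Rightarrow> snd (coords (level r)) | Variant_b \<Rightarrow> neg (snd (coords (level r))))"
    using r b by (auto simp: bipolar_admissible_def)
  show "fst (bipolar_pair v (impl r) (level r) ls) \<le> fst (bipolar_pair v (impl r) (level r) ls')"
    if "list_all2 (\<lambda>x y. fst (coords x) \<le> fst (coords y)) ls ls'"
    using min_level_mono[OF I(1,3) Min_image_mono_list[OF ne that]] by (simp add: bipolar_pair_def)
  \<comment> \<open>Stated for arbitrary lists so that \<open>ls\<close> and \<open>ls'\<close> can
    be inserted in either order.\<close>
  have snd: "snd (bipolar_pair v (impl r) (level r) xs) \<le> snd (bipolar_pair v (impl r) (level r) ys)"
    if xs: "xs \<noteq> []" and le: "list_all2 (\<lambda>x y. snd (coords x) \<le> snd (coords y)) xs ys" for xs ys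
  proof (cases v)
    case Variant_a
    then show ?thesis
      using min_level_mono[OF I(2) _ Min_image_mono_list[OF xs le]] I(4) by (simp add: bipolar_pair_def)
  next
    case Variant_b
    \<comment> \<open>The inner negation swaps the roles of the lists; the outer \<open>neg\<close>
      of variant b swaps them back.\<close>
    have "list_all2 (\<lambda>x y. neg (snd (coords x)) \<le> neg (snd (coords y))) ys xs"
      using le by (auto simp: list_all2_conv_all_nth intro: neg_antimono)
    moreover have "ys \<noteq> []"
      using xs le by auto
    ultimately have "Min ((\<lambda>l. neg (snd (coords l))) ` set ys) \<le> Min ((\<lambda>l. neg (snd (coords l))) ` set xs)"
      by (intro Min_image_mono_list)
    then show ?thesis
      using Variant_b min_level_mono[OF I(2)] I(4) by (simp add: bipolar_pair_def neg_antimono)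
  qed
  show "snd (bipolar_pair v (impl r) (level r) ls) \<le> snd (bipolar_pair v (impl r) (level r) ls')"
    if "list_all2 (\<lambda>x y. snd (coords x) \<le> snd (coords y)) ls ls'"
    using snd[OF ne that] .
  show "snd (bipolar_pair v (impl r) (level r) ls') \<le> snd (bipolar_pair v (impl r) (level r) ls)"
    if le: "list_all2 (\<lambda>x y. snd (coords y) \<le> snd (coords x)) ls ls'"
  proof (rule snd)
    show "ls' \<noteq> []"
      using ne le by auto
    show "list_all2 (\<lambda>x y. snd (coords x) \<le> snd (coords y)) ls' ls"
      using le by (auto simp: list_all2_conv_all_nth)
  qed
qed

text \<open>Admissibility gives existence for the \<open>THE\<close>, injectivity gives uniqueness.
  The class \<open>pair_lattice\<close> only fixes \<open>coords\<close>, so injectivity is assumed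
  here and proved separately for \<open>LF\<close> and \<open>LV\<close>.\<close>

lemma coords_bipolar_head_level:
  fixes r :: "('p, 't, 'l::pair_lattice, unit_interval implication \<times> unit_interval implication) rule"
  assumes inj: "inj (coords :: 'l \<Rightarrow> _)" and r: "bipolar_admissible v r"
    and len: "length ls = length (body r)" and ne: "ls \<noteq> []"
  shows "coords (bipolar_head_level v (impl r) (level r) ls) = bipolar_pair v (impl r) (level r) ls"
proof -
  have "body r \<noteq> []"
    using len ne by auto
  then obtain l :: 'l where l: "coords l = bipolar_pair v (impl r) (level r) ls"
    using r len by (fastforce simp: bipolar_admissible_def)
  then have "(THE l. coords l = bipolar_pair v (impl r) (level r) ls) = l"
    using inj by (auto simp: inj_def)
  then show ?thesis
    using l ne by (simp add: bipolar_head_level_def)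
qed

text \<open>The order of \<open>LF\<close>, written in coordinates, reverses the second one, which
  calls for \<open>bipolar_pair_antimono_snd\<close>.\<close>

lemma bipolar_head_level_mono_LF:
  fixes r :: "('p, 't, LF, unit_interval implication \<times> unit_interval implication) rule"
  assumes r: "bipolar_admissible v r"
  shows "head_level_mono (bipolar_head_level v) r"
  unfolding head_level_mono_def
proof (intro allI impI, elim conjE)
  fix ls ls' :: "LF list"
  assume len: "length ls = length (body r)" and le: "list_all2 (\<le>) ls ls'"
  show "bipolar_head_level v (impl r) (level r) ls \<le> bipolar_head_level v (impl r) (level r) ls'"
  proof (cases "ls = []")
    case True
    then show ?thesis
      using le by simp
  next
    case False
    have inj: "inj (coords :: LF \<Rightarrow> _)"
      by (simp add: inj_def coords_LF_def pair_LF_inject)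
    have ls': "length ls' = length (body r)" "ls' \<noteq> []"
      using False len le by (auto dest: list_all2_lengthD)
    have leF: "x \<le> y \<longleftrightarrow> fst (coords x) \<le> fst (coords y) \<and> snd (coords y) \<le> snd (coords x)" for x y :: LF
      by (simp add: less_eq_LF_def coords_LF_def)
    have "list_all2 (\<lambda>x y. fst (coords x) \<le> fst (coords y)) ls ls'"
        "list_all2 (\<lambda>x y. snd (coords y) \<le> snd (coords x)) ls ls'"
      using le by (auto simp: leF list_all2_conv_all_nth)
    then show ?thesis
      using bipolar_pair_mono_fst[OF r len False] bipolar_pair_antimono_snd[OF r len False]
      by (simp add: leF coords_bipolar_head_level[OF inj r] len False ls')
  qed
qed

text \<open>As for \<open>LF\<close>, but with both coordinates ordered the same way, hence
  \<open>bipolar_pair_mono_snd\<close>.\<close>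

lemma bipolar_head_level_mono_LV:
  fixes r :: "('p, 't, LV, unit_interval implication \<times> unit_interval implication) rule"
  assumes r: "bipolar_admissible v r"
  shows "head_level_mono (bipolar_head_level v) r"
  unfolding head_level_mono_def
proof (intro allI impI, elim conjE)
  fix ls ls' :: "LV list"
  assume len: "length ls = length (body r)" and le: "list_all2 (\<le>) ls ls'"
  show "bipolar_head_level v (impl r) (level r) ls \<le> bipolar_head_level v (impl r) (level r) ls'"
  proof (cases "ls = []")
    case True
    then show ?thesis
      using le by simp
  next
    case False
    have inj: "inj (coords :: LV \<Rightarrow> _)"
      by (simp add: inj_def coords_LV_def pair_LV_inject)
    have ls': "length ls' = length (body r)" "ls' \<noteq> []"
      using False len le by (auto dest: list_all2_lengthD)
    have leV: "x \<le> y \<longleftrightarrow> fst (coords x) \<le> fst (coords y) \<and> snd (coords x) \<le> snd (coords y)" for x y :: LV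
      by (simp add: less_eq_LV_def coords_LV_def)
    have "list_all2 (\<lambda>x y. fst (coords x) \<le> fst (coords y)) ls ls'"
        "list_all2 (\<lambda>x y. snd (coords x) \<le> snd (coords y)) ls ls'"
      using le by (auto simp: leV list_all2_conv_all_nth)
    then show ?thesis
      using bipolar_pair_mono_fst[OF r len False] bipolar_pair_mono_snd[OF r len False]
      by (simp add: leV coords_bipolar_head_level[OF inj r] len False ls')
  qed
qed

theorem proposition20:
  fixes arity :: "'p \<Rightarrow> nat"
  shows "(\<forall>(P :: ('p, 'c, 'v, unit_interval) lattice_program) Bk \<Phi>.
      datalog_program arity lattice_admissible P \<and> background_knowledge Bk \<and> function_set arity P \<Phi> \<longrightarrow>
      (\<exists>X. modNT_fixpoint arity lattice_head_level P Bk \<Phi> X) \<and>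
      (positive P \<longrightarrow> (\<exists>X. modNT_least_fixpoint arity lattice_head_level P Bk \<Phi> X))) \<and>
    (\<forall>(P :: ('p, 'c, 'v, LF) lattice_program) Bk \<Phi>.
      datalog_program arity lattice_admissible P \<and> background_knowledge Bk \<and> function_set arity P \<Phi> \<longrightarrow>
      (\<exists>X. modNT_fixpoint arity lattice_head_level P Bk \<Phi> X) \<and>
      (positive P \<longrightarrow> (\<exists>X. modNT_least_fixpoint arity lattice_head_level P Bk \<Phi> X))) \<and>
    (\<forall>(P :: ('p, 'c, 'v, LV) lattice_program) Bk \<Phi>.
      datalog_program arity lattice_admissible P \<and> background_knowledge Bk \<and> function_set arity P \<Phi> \<longrightarrow>
      (\<exists>X. modNT_fixpoint arity lattice_head_level P Bk \<Phi> X) \<and>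
      (positive P \<longrightarrow> (\<exists>X. modNT_least_fixpoint arity lattice_head_level P Bk \<Phi> X))) \<and>
    (\<forall>v (P :: ('p, 'c, 'v, LF) bipolar_program) Bk \<Phi>.
      datalog_program arity (bipolar_admissible v) P \<and> background_knowledge Bk \<and> function_set arity P \<Phi> \<longrightarrow>
      (\<exists>X. modNT_fixpoint arity (bipolar_head_level v) P Bk \<Phi> X) \<and>
      (positive P \<longrightarrow> (\<exists>X. modNT_least_fixpoint arity (bipolar_head_level v) P Bk \<Phi> X))) \<and>
    (\<forall>v (P :: ('p, 'c, 'v, LV) bipolar_program) Bk \<Phi>.
      datalog_program arity (bipolar_admissible v) P \<and> background_knowledge Bk \<and> function_set arity P \<Phi> \<longrightarrow>
      (\<exists>X. modNT_fixpoint arity (bipolar_head_level v) P Bk \<Phi> X) \<and>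
      (positive P \<longrightarrow> (\<exists>X. modNT_least_fixpoint arity (bipolar_head_level v) P Bk \<Phi> X)))"
  \<comment> \<open>The nested \<open>conjI\<close> splits a fivefold conjunction in one go and does
    not match the inner twofold ones, which thus keep the shape of
    \<open>fixpoint_and_least_fixpoint\<close>. The first three classes share
    \<open>lattice_head_level_mono\<close>.\<close>
  by (intro conjI[OF _ conjI[OF _ conjI[OF _ conjI]]] allI impI; elim conjE; rule fixpoint_and_least_fixpoint)
    (assumption | rule lattice_head_level_mono bipolar_head_level_mono_LF bipolar_head_level_mono_LV)+

end
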